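(* Let $e\ge1$ and $0\le k<2^{e-1}$ be integers. Then $$\nu\Bigl(\sum_{i=0}^k\bigl(\tbinom{2^e+2k+1}i^{-1}-\tbinom{2k+1}i^{-1}\bigr)\Bigr)\ge e-2\lg(k+2)+2\nu(k+1).$$ Indeed, setting $T_i:=\binom{2^e+2k+1}i^{-1}-\binom{2k+1}i^{-1}$, we have: (a) if $0\le i\le\lfloor (k-1)/2\rfloor$, then $\nu(T_{2i}+T_{2i+1})\ge e-2\lg(k+1)+2\nu(k+1)$; and (b) if $k$ is even, then $\nu(T_k)\ge e-2\lg(k+2)$.
   Context: $\nu(-)$ denotes the exponent of $2$ in a rational number (2-adic valuation, $\nu(0)=\infty$). $\lg(y)=\lfloor\log_2 y\rfloor$. *)

theory Defs
  imports Complex_Main "HOL-Library.Extended_Real" "HOL-Computational_Algebra.Primes"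
begin

text \<open>
  The 2-adic valuation on the rationals; \<open>quotient_of\<close> yields the reduced fraction, and the case
  \<open>q = 0\<close> must be separate because \<open>multiplicity 2 0 = 0\<close>.
\<close>

definition nu2 :: "rat \<Rightarrow> ereal" where
  "nu2 q = (if q = 0 then \<infinity>
     else ereal (real (multiplicity 2 (fst (quotient_of q)))
               - real (multiplicity 2 (snd (quotient_of q)))))"

definition lg :: "real \<Rightarrow> int" where
  "lg y = \<lfloor>log 2 y\<rfloor>"

definition T :: "nat \<Rightarrow> nat \<Rightarrow> nat \<Rightarrow> rat" where
  "T e k i = inverse (of_nat ((2 ^ e + 2 * k + 1) choose i))
           - inverse (of_nat ((2 * k + 1) choose i))"

end

theory Submission
  imports Defs
begin

text \<open>
  Adjacent reciprocals combine to a single one: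
  \<open>1/C(n+1,j) + 1/C(n+1,j+1) = (n+2) / ((n+1) C(n,j))\<close>. Applied with \<open>j = 2i\<close> to \<open>n = 2k\<close> and
  \<open>n = 2^e + 2k\<close>, it writes \<open>T_{2i} + T_{2i+1}\<close> as \<open>(2k+2) / ((2k+1) C(2k,2i))\<close> times a difference
  \<open>P - 1\<close>, where \<open>P\<close> is a product of factors \<open>1 + 2^e/m\<close> and inverses of such factors, with
  \<open>0 < m \<le> 2k+2\<close>; this difference has valuation at least \<open>e - 1 - lg (k+1)\<close>.
  Moreover \<open>C(2k,2i)\<close> and \<open>C(k,i)\<close> have equal valuation, and the same identity,
  read as the recurrence of Leibniz' harmonic triangle, shows that \<open>(k+1) C(k,i)\<close> has valuation
  at most \<open>lg (k+1)\<close>. For even \<open>k\<close> the unpaired term is treated in the same way, using that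
  \<open>C(2k,k)\<close> has valuation \<open>k - \<nu>(k!)\<close> and \<open>2^(n - \<nu>(n!)) \<le> n + 1\<close>.
\<close>

section \<open>Multiples of powers of two in the localization of the integers at 2\<close>

text \<open>This is membership in the fractional ideal generated by \<open>2 powi n\<close> in the
  localization at 2. Unlike \<open>nu2\<close> it avoids reduced fractions and an infinite value at
  0, so sums and products only require multiplying odd denominators.\<close>

definition val2_ge :: "int \<Rightarrow> rat \<Rightarrow> bool" where
  "val2_ge n q \<longleftrightarrow> (\<exists>a b :: int. odd b \<and> q = 2 powi n * of_int a / of_int b)"

lemma val2_geI: "odd b \<Longrightarrow> q = 2 powi n * of_int a / of_int b \<Longrightarrow> val2_ge n q"
  by (auto simp: val2_ge_def)

lemma val2_geE:
  assumes "val2_ge n q"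
  obtains a b :: int where "odd b" "b \<noteq> 0" "q = 2 powi n * of_int a / of_int b"
  using assms unfolding val2_ge_def by (metis even_zero)

lemma val2_ge_0 [simp]: "val2_ge n 0"
  by (rule val2_geI[of 1 _ _ 0]) auto

lemma val2_ge_of_int: "val2_ge 0 (of_int a)"
  by (rule val2_geI[of 1 _ _ a]) auto

lemma val2_ge_mono:
  assumes "val2_ge n q" "m \<le> n" shows "val2_ge m q"
proof -
  from assms(1) obtain a b :: int where ab: "odd b" "q = 2 powi n * of_int a / of_int b"
    by (rule val2_geE)
  have "(2::rat) powi n = 2 powi (m + int (nat (n - m)))"
    using assms(2) by (simp del: int_nat_eq add: nat_0_le)
  also have "\<dots> = 2 powi m * of_int (2 ^ nat (n - m))"
    by (subst power_int_add) (auto simp del: int_nat_eq)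
  finally show ?thesis using ab by (intro val2_geI[of b _ _ "2 ^ nat (n - m) * a"]) auto
qed

lemma val2_ge_mult:
  assumes "val2_ge m p" "val2_ge n q" shows "val2_ge (m + n) (p * q)"
proof -
  from assms(1) obtain a b :: int where ab: "odd b" "p = 2 powi m * of_int a / of_int b"
    by (rule val2_geE)
  from assms(2) obtain c d :: int where cd: "odd d" "q = 2 powi n * of_int c / of_int d"
    by (rule val2_geE)
  show ?thesis using ab cd
    by (intro val2_geI[of "b * d" _ _ "a * c"]) (auto simp: power_int_add)
qed

lemma val2_ge_add:
  assumes "val2_ge n p" "val2_ge n q" shows "val2_ge n (p + q)"
proof -
  from assms(1) obtain a b :: int where ab: "odd b" "b \<noteq> 0" "p = 2 powi n * of_int a / of_int b"
    by (rule val2_geE)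
  from assms(2) obtain c d :: int where cd: "odd d" "d \<noteq> 0" "q = 2 powi n * of_int c / of_int d"
    by (rule val2_geE)
  show ?thesis using ab cd
    by (intro val2_geI[of "b * d" _ _ "a * d + b * c"]) (auto simp: field_simps)
qed

lemma val2_ge_minus: "val2_ge n p \<Longrightarrow> val2_ge n (- p)"
  using val2_ge_mult[OF val2_ge_of_int[of "-1"], of n p] by simp

lemma val2_ge_diff: "val2_ge n p \<Longrightarrow> val2_ge n q \<Longrightarrow> val2_ge n (p - q)"
  using val2_ge_add[of n p "- q"] val2_ge_minus[of n q] by simp

lemma val2_ge_sum: "(\<And>i. i \<in> A \<Longrightarrow> val2_ge n (f i)) \<Longrightarrow> val2_ge n (\<Sum>i\<in>A. f i)"
  by (induction A rule: infinite_finite_induct) (auto intro: val2_ge_add)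

lemma val2_ge_pow2: "val2_ge (int e) (2 ^ e)"
  by (rule val2_geI[of 1 _ _ 1]) auto

lemma odd_part_nat:
  fixes n :: nat
  assumes "n > 0" obtains y where "n = 2 ^ multiplicity 2 n * y" "odd y"
  using multiplicity_decompose'[of n 2] assms by auto

lemma val2_ge_of_nat:
  assumes "n > 0" shows "val2_ge (int (multiplicity 2 n)) (of_nat n)"
proof -
  obtain y where y: "n = 2 ^ multiplicity 2 n * y" by (rule odd_part_nat[OF assms])
  have "(of_nat n :: rat) = 2 ^ multiplicity 2 n * of_nat y"
    by (subst y) simp
  then show ?thesis by (intro val2_geI[of 1 _ _ "int y"]) simp_all
qed

text \<open>This bridge lets a bound proved by adding rationals be read back as a bound on
  \<open>multiplicity\<close>. For the converse, clearing denominators gives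
  \<open>2 ^ t * b = n * a\<close>, and the 2-part of \<open>n\<close> is coprime to the odd
  \<open>b\<close>.\<close>

lemma val2_ge_inverse_of_nat_iff:
  assumes "n > 0"
  shows "val2_ge (- int t) (inverse (of_nat n)) \<longleftrightarrow> multiplicity 2 n \<le> t"
proof
  obtain y where y: "n = 2 ^ multiplicity 2 n * y" "odd y" by (rule odd_part_nat[OF assms])
  have "(of_nat n :: rat) = 2 ^ multiplicity 2 n * of_nat y"
    by (subst y(1)) simp
  then have "val2_ge (- int (multiplicity 2 n)) (inverse (of_nat n))"
    using y(2) by (intro val2_geI[of "int y" _ _ 1]) (simp_all add: power_int_minus field_simps)
  then show "val2_ge (- int t) (inverse (of_nat n))" if "multiplicity 2 n \<le> t"
    by (rule val2_ge_mono) (use that in simp)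
next
  assume "val2_ge (- int t) (inverse (of_nat n))"
  then obtain a b :: int where ab: "odd b" "b \<noteq> 0"
    "inverse (of_nat n) = (2 powi (- int t) * of_int a / of_int b :: rat)" by (rule val2_geE)
  have "(of_int (2 ^ t * b) :: rat) = of_int (int n * a)"
    using ab assms by (simp add: power_int_minus field_simps)
  then have *: "2 ^ t * b = int n * a" by (simp only: of_int_eq_iff)
  obtain y where y: "n = 2 ^ multiplicity 2 n * y" by (rule odd_part_nat[OF assms])
  have "int n = 2 ^ multiplicity 2 n * int y" by (subst y) simp
  then have "2 ^ multiplicity 2 n dvd 2 ^ t * b" using * by simp
  moreover have "coprime (2 ^ multiplicity 2 n) b" using ab(1) by simp
  ultimately have "(2::int) ^ multiplicity 2 n dvd 2 ^ t"
    using coprime_dvd_mult_left_iff by blast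
  then show "multiplicity 2 n \<le> t"
    by (auto dest: zdvd_imp_le)
qed

lemma multiplicity_2_less_power:
  fixes m :: nat
  assumes "0 < m" "m < 2 ^ Suc s" shows "multiplicity 2 m \<le> s"
proof -
  have "2 ^ multiplicity 2 m \<le> m"
    using assms(1) by (intro dvd_imp_le multiplicity_dvd)
  then have "(2::nat) ^ multiplicity 2 m < 2 ^ Suc s" using assms(2) by linarith
  then show ?thesis by (metis less_Suc_eq_le one_less_numeral_iff power_less_imp_less_exp semiring_norm(76))
qed

lemma val2_ge_inverse_less_power:
  "0 < m \<Longrightarrow> m < 2 ^ Suc s \<Longrightarrow> val2_ge (- int s) (inverse (of_nat m))"
  by (simp add: val2_ge_inverse_of_nat_iff multiplicity_2_less_power)

lemma nu2_ge_if_val2_ge: "nu2 q \<ge> ereal (of_int n)" if "val2_ge n q"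
proof (cases "q = 0")
  case False
  from that obtain a b :: int where ab: "odd b" "b \<noteq> 0" "q = 2 powi n * of_int a / of_int b"
    by (rule val2_geE)
  have "a \<noteq> 0" using ab False by auto
  obtain p d where pd: "quotient_of q = (p, d)" by (cases "quotient_of q")
  have "d > 0" using quotient_of_denom_pos[OF pd] .
  have q: "q = of_int p / of_int d" using quotient_of_div[OF pd] .
  have "p \<noteq> 0" using False q by auto
  have "multiplicity 2 b = 0" using ab(1) by (simp add: not_dvd_imp_multiplicity_0)
  have *: "of_int p * of_int b = (2 powi n * of_int a * of_int d :: rat)"
    using q ab \<open>d > 0\<close> by (simp add: field_simps)
  have "int (multiplicity 2 p) = n + int (multiplicity 2 a) + int (multiplicity 2 d)"
  \<comment> \<open>The sign of \<open>n\<close> decides on which side the power of two becomes an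
    integer factor.\<close>
  proof (cases "n \<ge> 0")
    case True
    then have "(of_int (p * b) :: rat) = of_int (2 ^ nat n * a * d)"
      using * by (simp add: power_int_def)
    then have "p * b = 2 ^ nat n * a * d" by (simp only: of_int_eq_iff)
    then have "multiplicity 2 (p * b) = multiplicity 2 (2 ^ nat n * a * d)" by simp
    then show ?thesis using \<open>a \<noteq> 0\<close> \<open>p \<noteq> 0\<close> ab(2) \<open>d > 0\<close> True \<open>multiplicity 2 b = 0\<close>
      by (simp add: prime_elem_multiplicity_mult_distrib)
  next
    case neg: False
    then have "(of_int (2 ^ nat (- n) * p * b) :: rat) = of_int (a * d)"
      using * by (simp add: power_int_def field_simps)
    then have "2 ^ nat (- n) * p * b = a * d" by (simp only: of_int_eq_iff)
    then have "multiplicity 2 (2 ^ nat (- n) * p * b) = multiplicity 2 (a * d)" by simp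
    then show ?thesis using \<open>a \<noteq> 0\<close> \<open>p \<noteq> 0\<close> ab(2) \<open>d > 0\<close> neg \<open>multiplicity 2 b = 0\<close>
      by (simp add: prime_elem_multiplicity_mult_distrib)
  qed
  then have "of_int n \<le> real (multiplicity 2 p) - real (multiplicity 2 d)" by linarith
  then show ?thesis using False pd by (simp add: nu2_def)
qed (simp add: nu2_def)

text \<open>\<open>nu2\<close> takes \<open>multiplicity\<close> over the integers, the counting
  lemmas over the naturals; the odd part shows that both agree.\<close>

lemma nu2_of_nat:
  assumes "n > 0" shows "nu2 (of_nat n) = ereal (real (multiplicity 2 n))"
proof -
  have "multiplicity 2 (int n) = multiplicity 2 n"
  proof -
    obtain y where y: "n = 2 ^ multiplicity 2 n * y" "odd y" by (rule odd_part_nat[OF assms])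
    then have "y \<noteq> 0" by (metis even_zero)
    have "int n = 2 ^ multiplicity 2 n * int y" by (subst y(1)) simp
    moreover have "multiplicity 2 (int y) = 0" using y(2) by (simp add: not_dvd_imp_multiplicity_0)
    ultimately show ?thesis
      using \<open>y \<noteq> 0\<close> by (simp only:) (simp add: prime_elem_multiplicity_mult_distrib)
  qed
  then show ?thesis using assms by (simp add: nu2_def quotient_of_int[of "int n", simplified])
qed

section \<open>Rationals close to 1\<close>

text \<open>Such a \<open>q\<close> is a quotient \<open>(b + 2 * a) / b\<close> of odd integers,
  hence a unit of the localization.\<close>

lemma val2_ge_unit:
  assumes "val2_ge 1 (q - 1)" shows "val2_ge 0 q" "val2_ge 0 (inverse q)" "q \<noteq> 0"
proof -
  from assms obtain a b :: int where ab: "odd b" "b \<noteq> 0" "q - 1 = 2 powi 1 * of_int a / of_int b"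
    by (rule val2_geE)
  have odd: "odd (b + 2 * a)" using ab(1) by simp
  then have nz: "b + 2 * a \<noteq> 0" by (metis even_zero)
  have q: "q = of_int (b + 2 * a) / of_int b"
    using ab by (simp add: field_simps)
  show "q \<noteq> 0" unfolding q using nz ab(2) by (simp only: divide_eq_0_iff of_int_eq_0_iff simp_thms)
  show "val2_ge 0 q" using q ab(1) by (intro val2_geI[of b _ _ "b + 2 * a"]) simp_all
  show "val2_ge 0 (inverse q)"
    using odd unfolding q by (intro val2_geI[of "b + 2 * a" _ _ b]) simp_all
qed

lemma val2_ge_mult_minus_1:
  assumes "val2_ge r (p - 1)" "val2_ge r (q - 1)" "val2_ge 0 q"
  shows "val2_ge r (p * q - 1)"
proof -
  have "p * q - 1 = (p - 1) * q + (q - 1)" by (simp add: algebra_simps)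
  then show ?thesis using val2_ge_add[of r "(p - 1) * q" "q - 1"] val2_ge_mult[OF assms(1,3)] assms(2)
    by (simp only:) simp
qed

lemma val2_ge_inverse_minus_1:
  assumes "val2_ge r (q - 1)" "val2_ge 1 (q - 1)" shows "val2_ge r (inverse q - 1)"
proof -
  have "inverse q - 1 = - ((q - 1) * inverse q)"
    using val2_ge_unit(3)[OF assms(2)] by (simp add: field_simps)
  then show ?thesis
    using val2_ge_mult[OF assms(1) val2_ge_unit(2)[OF assms(2)]] by (simp add: val2_ge_minus)
qed

text \<open>Both bounds run through one induction: congruence to 1 modulo 2 makes the partial
  product integral, which the multiplicative step requires, and \<open>r\<close> may be smaller than
  1.\<close>

lemma val2_ge_prod_minus_1:
  assumes "\<And>i. i \<in> A \<Longrightarrow> val2_ge r (f i - 1)" "\<And>i. i \<in> A \<Longrightarrow> val2_ge 1 (f i - 1)"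
  shows "val2_ge r (prod f A - 1) \<and> val2_ge 1 (prod f A - 1)"
  using assms
proof (induction A rule: infinite_finite_induct)
  case (insert x A)
  then have IH: "val2_ge r (prod f A - 1)" "val2_ge 1 (prod f A - 1)" by auto
  then show ?case using insert.hyps insert.prems
    by (auto intro!: val2_ge_mult_minus_1 val2_ge_unit(1))
qed auto

lemma val2_ge_pow2_div:
  assumes "0 < m" "m < 2 ^ Suc s"
  shows "val2_ge (int e - int s) (2 ^ e / of_nat m)"
  using val2_ge_mult[OF val2_ge_pow2[of e] val2_ge_inverse_less_power[OF assms]]
  by (simp add: divide_inverse)

section \<open>Binomial coefficients\<close>

text \<open>Over the common denominator \<open>(n + 1) * (n choose j)\<close> the numerators are
  \<open>n + 1 - j\<close> and \<open>j + 1\<close>, with sum \<open>n + 2\<close>.\<close>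

lemma inverse_binomial_add_adjacent:
  assumes "j \<le> n"
  shows "inverse (of_nat (Suc n choose j)) + inverse (of_nat (Suc n choose Suc j))
    = (of_nat (n + 2) / (of_nat (n + 1) * of_nat (n choose j)) :: rat)"
proof -
  have "Suc n * (n choose j) = (Suc n choose Suc j) * Suc j" by (rule Suc_times_binomial_eq)
  then have 1: "(of_nat (Suc n) * of_nat (n choose j) :: rat)
      = of_nat (Suc n choose Suc j) * of_nat (Suc j)"
    by (metis of_nat_mult)
  have "(Suc n - j) * (Suc n choose j) = Suc n * (n choose j)"
    using binomial_absorb_comp[of "Suc n" j] by simp
  then have 2: "(of_nat (Suc n) * of_nat (n choose j) :: rat)
      = of_nat (Suc n - j) * of_nat (Suc n choose j)"
    by (metis of_nat_mult)
  have pos: "(of_nat (n choose j) :: rat) \<noteq> 0" "(of_nat (Suc n choose j) :: rat) \<noteq> 0"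
    "(of_nat (Suc n choose Suc j) :: rat) \<noteq> 0" "(of_nat (Suc n) :: rat) \<noteq> 0"
    using assms by (simp_all del: of_nat_Suc binomial_Suc_Suc)
  have "inverse (of_nat (Suc n choose j)) =
      (of_nat (Suc n - j) / (of_nat (Suc n) * of_nat (n choose j)) :: rat)"
    unfolding 2 using pos assms by (subst nonzero_divide_mult_cancel_left) (auto simp: inverse_eq_divide)
  moreover have "inverse (of_nat (Suc n choose Suc j)) =
      (of_nat (Suc j) / (of_nat (Suc n) * of_nat (n choose j)) :: rat)"
    unfolding 1 by (subst nonzero_divide_mult_cancel_right)
      (auto simp: inverse_eq_divide simp del: of_nat_Suc)
  moreover have "of_nat (Suc n - j) + of_nat (Suc j) = (of_nat (n + 2) :: rat)"
    using assms by (simp add: of_nat_diff)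
  ultimately show ?thesis by (simp add: add_divide_distrib[symmetric] del: of_nat_Suc binomial_Suc_Suc)
qed

text \<open>In the harmonic triangle, entry \<open>i + 1\<close> of row \<open>k\<close> is entry
  \<open>i\<close> of row \<open>k - 1\<close> minus entry \<open>i\<close> of row \<open>k\<close>.
  So all entries up to row \<open>k\<close> are integer combinations of the first entries
  \<open>1 / m\<close> with \<open>m \<le> k + 1\<close>.\<close>

lemma val2_ge_leibniz:
  assumes "i \<le> k" "k + 1 < 2 ^ Suc s"
  shows "val2_ge (- int s) (inverse (of_nat ((k + 1) * (k choose i))))"
  using assms
proof (induction i arbitrary: k)
  case 0
  then show ?case using val2_ge_inverse_less_power[of "k + 1" s] by simp
next
  case (Suc i)
  then obtain n where k: "k = Suc n" by (cases k) auto
  have "i \<le> n" using Suc.prems k by simp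
  define x y z :: rat where "x = of_nat (n + 2)" "y = of_nat (n + 1)" "z = of_nat (n choose i)"
  define c d :: rat where "c = of_nat (Suc n choose i)" "d = of_nat (Suc n choose Suc i)"
  have "inverse c + inverse d = x / (y * z)"
    using inverse_binomial_add_adjacent[OF \<open>i \<le> n\<close>] by (simp add: x_y_z_def c_d_def)
  then have "inverse x * inverse d = inverse x * (x * inverse (y * z)) - inverse x * inverse c"
    by (simp add: divide_inverse flip: right_diff_distrib)
  moreover have "x \<noteq> 0" by (simp add: x_y_z_def)
  ultimately have "inverse (x * d) = inverse (y * z) - inverse (x * c)"
    by (simp flip: mult.assoc)
  moreover have "val2_ge (- int s) (inverse (y * z))"
    using Suc.IH[OF \<open>i \<le> n\<close>] Suc.prems k unfolding x_y_z_def of_nat_mult by simp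
  moreover have "val2_ge (- int s) (inverse (x * c))"
    using Suc.IH[of k] Suc.prems k unfolding x_y_z_def c_d_def of_nat_mult
    by (simp add: add.commute)
  ultimately have "val2_ge (- int s) (inverse (x * d))" by (simp only: val2_ge_diff)
  moreover have "of_nat ((k + 1) * (k choose Suc i)) = x * d"
    unfolding x_y_z_def c_d_def k of_nat_mult by simp
  ultimately show ?case by (simp only:)
qed

text \<open>The quotient of the two coefficients is the product of
  \<open>(E + n - l) / (n - l)\<close>; since \<open>l < j \<le> n\<close>, no denominator
  vanishes.\<close>

lemma binomial_add_eq_prod:
  assumes "j \<le> n"
  shows "of_nat ((E + n) choose j)
    = (of_nat (n choose j) * (\<Prod>l<j. 1 + of_nat E / of_nat (n - l)) :: rat)"
  using assms
proof (induction j)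
  case (Suc j)
  have step: "of_nat (m choose Suc j) * of_nat (Suc j) = (of_nat (m choose j) * of_nat (m - j) :: rat)"
    for m
    by (metis binomial_absorb_comp binomial_absorption mult.commute of_nat_mult)
  have "of_nat ((E + n) choose Suc j) * of_nat (Suc j)
      = (of_nat ((E + n) choose j) * of_nat (E + n - j) :: rat)" by (rule step)
  also have "\<dots> = of_nat (n choose j) * (\<Prod>l<j. 1 + of_nat E / of_nat (n - l))
      * (of_nat (n - j) * (1 + of_nat E / of_nat (n - j)))"
    using Suc by (simp add: field_simps of_nat_diff)
  also have "\<dots> = of_nat (n choose Suc j) * of_nat (Suc j)
      * (\<Prod>l<Suc j. 1 + of_nat E / of_nat (n - l))"
    unfolding step by simp
  finally show ?case by (simp del: of_nat_Suc)
qed simp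

section \<open>Valuations of factorials and binomial coefficients\<close>

lemma multiplicity_2_fact_double: "multiplicity 2 (fact (2 * n) :: nat) = n + multiplicity 2 (fact n :: nat)"
proof (induction n)
  case (Suc n)
  \<comment> \<open>Of the two new factors, \<open>2 * n + 1\<close> is odd and
    \<open>2 * n + 2\<close> contributes one 2 besides \<open>n + 1\<close>.\<close>
  have "fact (2 * Suc n) = 2 * (Suc n * (Suc (2 * n) * fact (2 * n) :: nat))"
    by (simp add: algebra_simps)
  moreover have "multiplicity 2 (Suc (2 * n)) = 0"
    by (rule not_dvd_imp_multiplicity_0) simp
  ultimately show ?case using Suc
    by (simp add: prime_elem_multiplicity_mult_distrib del: mult_Suc_right mult_Suc)
qed simp

lemma multiplicity_2_binomial:
  assumes "i \<le> n"
  shows "multiplicity 2 (n choose i) + multiplicity 2 (fact i :: nat)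
    + multiplicity 2 (fact (n - i) :: nat) = multiplicity 2 (fact n :: nat)"
proof -
  have "fact n = (n choose i) * fact i * (fact (n - i) :: nat)"
    using binomial_fact_lemma[OF assms] by (simp add: ac_simps)
  then show ?thesis using assms by (simp add: prime_elem_multiplicity_mult_distrib)
qed

text \<open>Doubling adds \<open>n\<close>, \<open>i\<close> and \<open>n - i\<close> to the
  valuations of the three factorials, and these contributions cancel.\<close>

lemma multiplicity_2_binomial_double:
  assumes "i \<le> n"
  shows "multiplicity 2 ((2 * n) choose (2 * i)) = multiplicity 2 (n choose i)"
proof -
  have "multiplicity 2 (fact (2 * n - 2 * i) :: nat) = n - i + multiplicity 2 (fact (n - i) :: nat)"
    using multiplicity_2_fact_double[of "n - i"] by (simp add: diff_mult_distrib2)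
  then show ?thesis
    using multiplicity_2_binomial[OF assms] multiplicity_2_binomial[of "2 * i" "2 * n"] assms
    by (simp add: multiplicity_2_fact_double)
qed

text \<open>By Legendre, \<open>n - \<nu>(n!)\<close> is the binary digit sum of \<open>n\<close>,
  and a number with digit sum \<open>d\<close> is at least \<open>2 ^ d - 1\<close>. The induction
  halves \<open>n\<close> instead of mentioning digits.\<close>

lemma pow2_le_fact_multiplicity: "2 ^ n \<le> (n + 1) * 2 ^ multiplicity 2 (fact n :: nat)"
proof (induction n rule: less_induct)
  case (less n)
  show ?case
  proof (cases "n = 0")
    case False
    define m where "m = n div 2"
    have IH: "2 ^ m \<le> (m + 1) * 2 ^ multiplicity 2 (fact m :: nat)"
      using less False by (simp add: m_def)
    show ?thesis
    proof (cases "even n")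
      case True
      then have n: "n = 2 * m" by (simp add: m_def)
      have "(2::nat) ^ n = 2 ^ m * 2 ^ m" by (simp add: n power_add mult_2)
      also have "\<dots> \<le> 2 ^ m * ((m + 1) * 2 ^ multiplicity 2 (fact m :: nat))" using IH by simp
      also have "\<dots> \<le> 2 ^ m * ((n + 1) * 2 ^ multiplicity 2 (fact m :: nat))" by (simp add: n)
      also have "\<dots> = (n + 1) * 2 ^ multiplicity 2 (fact n :: nat)"
        unfolding n multiplicity_2_fact_double by (simp add: power_add algebra_simps)
      finally show ?thesis .
    next
      case odd: False
      then have n: "n = Suc (2 * m)" by (simp add: m_def)
      have "multiplicity 2 (Suc (2 * m)) = 0" by (rule not_dvd_imp_multiplicity_0) simp
      then have v: "multiplicity 2 (fact n :: nat) = m + multiplicity 2 (fact m :: nat)"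
        unfolding n fact_Suc
        by (simp add: prime_elem_multiplicity_mult_distrib multiplicity_2_fact_double del: mult_Suc)
      have "(2::nat) ^ n = 2 * 2 ^ m * 2 ^ m" by (simp add: n mult_2 power_add distrib_right)
      also have "\<dots> \<le> 2 * 2 ^ m * ((m + 1) * 2 ^ multiplicity 2 (fact m :: nat))" using IH by simp
      also have "\<dots> = (n + 1) * 2 ^ multiplicity 2 (fact n :: nat)"
        unfolding v by (simp add: n power_add algebra_simps)
      finally show ?thesis .
    qed
  qed simp
qed

text \<open>As \<open>k + 1\<close> and \<open>2 * k + 1\<close> are odd, \<open>2 * k + 1\<close>
  may be replaced by \<open>2 * k\<close>. The valuation is then \<open>k - \<nu>(k!)\<close>, which
  equals \<open>n - \<nu>(n!)\<close> because \<open>k = 2 * n\<close>.\<close>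

lemma multiplicity_2_binomial_near_middle:
  assumes "k = 2 * n" shows "2 ^ multiplicity 2 ((2 * k + 1) choose k) \<le> n + 1"
proof -
  let ?v = "multiplicity (2::nat)"
  have odd: "?v (k + 1) = 0" "?v (2 * k + 1) = 0"
    using assms by (auto intro!: not_dvd_imp_multiplicity_0)
  have "(k + 1) * ((2 * k + 1) choose k) = (2 * k + 1) * ((2 * k) choose k)"
    using binomial_absorb_comp[of "2 * k + 1" k] by (simp add: algebra_simps)
  then have "?v ((k + 1) * ((2 * k + 1) choose k)) = ?v ((2 * k + 1) * ((2 * k) choose k))" by simp
  then have "?v ((2 * k + 1) choose k) = ?v ((2 * k) choose k)"
    using odd by (simp add: prime_elem_multiplicity_mult_distrib del: mult_Suc binomial_Suc_Suc)
  moreover have "?v ((2 * k) choose k) + ?v (fact k) = k"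
    using multiplicity_2_binomial[of k "2 * k"] by (simp add: multiplicity_2_fact_double)
  ultimately have "?v ((2 * k + 1) choose k) + ?v (fact n) = n"
    using assms multiplicity_2_fact_double[of n] by simp
  then have "2 ^ ?v ((2 * k + 1) choose k) * 2 ^ ?v (fact n) \<le> (n + 1) * 2 ^ ?v (fact n)"
    using pow2_le_fact_multiplicity[of n] by (metis power_add)
  then show ?thesis by (subst (asm) mult_le_cancel2) simp
qed

section \<open>Valuation of differences of reciprocal binomial coefficients\<close>

lemma lg_of_nat_eq:
  assumes "0 < n" obtains s where "lg (real n) = int s" "2 ^ s \<le> n" "n < 2 ^ Suc s"
proof -
  obtain s where s: "2 ^ s \<le> n" "n < 2 ^ (s + 1)" using ex_power_ivl1[of 2 n] assms by auto
  moreover have "lg (real n) = int s"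
    unfolding lg_def using floor_log_nat_eq_if[OF s] by simp
  ultimately show ?thesis using that by simp
qed

lemma val2_ge_prod_pow2_div_minus_1:
  assumes "j \<le> n" "n < 2 ^ e" "n < 2 ^ Suc s" "e \<ge> 1"
  shows "val2_ge (int e - int s) ((\<Prod>l<j. 1 + of_nat (2 ^ e) / of_nat (n - l)) - 1)"
    and "val2_ge 1 ((\<Prod>l<j. 1 + of_nat (2 ^ e) / of_nat (n - l)) - 1)"
proof -
  have "val2_ge (int e - int s) (2 ^ e / of_nat (n - l))" "val2_ge 1 (2 ^ e / of_nat (n - l))"
    if "l < j" for l
    \<comment> \<open>The instance with \<open>e - 1\<close> for \<open>s\<close> gives the bound
      \<open>e - (e - 1) = 1\<close>, by \<open>n < 2 ^ e\<close>.\<close>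
    using that assms val2_ge_pow2_div[of "n - l" s e] val2_ge_pow2_div[of "n - l" "e - 1" e]
    by (auto simp: of_nat_diff)
  then show "val2_ge (int e - int s) ((\<Prod>l<j. 1 + of_nat (2 ^ e) / of_nat (n - l)) - 1)"
    "val2_ge 1 ((\<Prod>l<j. 1 + of_nat (2 ^ e) / of_nat (n - l)) - 1)"
    using val2_ge_prod_minus_1[of "{..<j}" "int e - int s" "\<lambda>l. 1 + of_nat (2 ^ e) / of_nat (n - l)"]
    by auto
qed

lemma val2_ge_T_pair:
  assumes "e \<ge> 1" "k < 2 ^ (e - 1)" "2 * i + 1 \<le> k" "k + 1 < 2 ^ Suc s"
  shows "val2_ge (int e - 2 * int s + 2 * int (multiplicity 2 (k + 1)))
    (T e k (2 * i) + T e k (2 * i + 1))"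
proof -
  let ?v = "int (multiplicity 2 (k + 1))"
  \<comment> \<open>The denominators reach \<open>2 * k + 2 < 2 ^ (s + 2)\<close>, hence
    \<open>Suc s\<close>.\<close>
  define r where "r = int e - int (Suc s)"
  define P :: rat where "P = (\<Prod>l<2 * i. 1 + of_nat (2 ^ e) / of_nat (2 * k - l))"
  define x :: rat where "x = 1 + 2 ^ e / of_nat (2 * k + 2)"
  define y :: rat where "y = 1 + 2 ^ e / of_nat (2 * k + 1)"
  define C :: rat where "C = of_nat ((2 * k) choose (2 * i))"
  have "(2::nat) ^ e = 2 * 2 ^ (e - 1)" using assms(1) by (cases e) auto
  then have small: "2 * k + 1 < 2 ^ e" using assms(2) by simp
  have P: "val2_ge r (P - 1)" "val2_ge 1 (P - 1)"
    using val2_ge_prod_pow2_div_minus_1[of "2 * i" "2 * k" e "Suc s"] assms small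
    by (simp_all add: P_def r_def)
  \<comment> \<open>There is no bound 1 here: if \<open>k + 1 = 2 ^ (e - 1)\<close>, then
    \<open>x = 2\<close>. Hence \<open>x\<close> is the left factor in \<open>bracket\<close>, where
    only the right one must be integral.\<close>
  have x: "val2_ge r (x - 1)"
    using val2_ge_pow2_div[of "2 * k + 2" "Suc s" e] assms(4) by (simp add: x_def r_def)
  have y: "val2_ge r (y - 1)" "val2_ge 1 (y - 1)"
    using val2_ge_pow2_div[of "2 * k + 1" "Suc s" e] val2_ge_pow2_div[of "2 * k + 1" "e - 1" e]
      assms small by (simp_all add: y_def r_def)
  have bracket: "val2_ge r (x * (inverse y * inverse P) - 1)"
    using val2_ge_mult[OF val2_ge_unit(2)[OF y(2)] val2_ge_unit(2)[OF P(2)]]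
    by (intro val2_ge_mult_minus_1 val2_ge_inverse_minus_1 val2_ge_unit(2) x y P) simp

  have "T e k (2 * i) + T e k (2 * i + 1)
    = of_nat (2 ^ e + 2 * k + 2) / (of_nat (2 ^ e + 2 * k + 1) * of_nat ((2 ^ e + 2 * k) choose (2 * i)))
    - of_nat (2 * k + 2) / (of_nat (2 * k + 1) * C)"
    using inverse_binomial_add_adjacent[of "2 * i" "2 * k"]
      inverse_binomial_add_adjacent[of "2 * i" "2 ^ e + 2 * k"] assms(3)
    unfolding T_def C_def by (simp del: binomial_Suc_Suc)
  also have "of_nat ((2 ^ e + 2 * k) choose (2 * i)) = C * P"
    unfolding C_def P_def using assms(3) by (intro binomial_add_eq_prod) simp
  also have "of_nat (2 ^ e + 2 * k + 2) = of_nat (2 * k + 2) * x"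
    by (simp add: x_def field_simps)
  also have "of_nat (2 ^ e + 2 * k + 1) = of_nat (2 * k + 1) * y"
    unfolding y_def by (subst ring_distribs(1)) (simp del: of_nat_Suc, simp)
  also have "a * x / (b * y * (C * P)) - a / (b * C)
      = a * inverse b * inverse C * (x * (inverse y * inverse P) - 1)" for a b
    by (simp add: divide_inverse algebra_simps)
  finally have T: "T e k (2 * i) + T e k (2 * i + 1)
    = of_nat (2 * k + 2) * inverse (of_nat (2 * k + 1)) * inverse C * (x * (inverse y * inverse P) - 1)" .

  have 1: "val2_ge (1 + ?v) (of_nat (2 * k + 2))"
    using val2_ge_mult[OF val2_ge_pow2[of 1] val2_ge_of_nat[of "k + 1"]] by simp
  have "multiplicity 2 (2 * k + 1) = 0" by (rule not_dvd_imp_multiplicity_0) simp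
  then have 2: "val2_ge 0 (inverse (of_nat (2 * k + 1)))"
    using val2_ge_inverse_of_nat_iff[of "2 * k + 1" 0] by simp
  have "multiplicity 2 ((k + 1) * (k choose i)) \<le> s"
    using val2_ge_leibniz[of i k s] assms(3,4)
    by (subst (asm) val2_ge_inverse_of_nat_iff) auto
  then have "multiplicity 2 (k + 1) + multiplicity 2 (k choose i) \<le> s"
    using assms(3) by (simp add: prime_elem_multiplicity_mult_distrib del: mult_Suc)
  \<comment> \<open>The second inequality guards the truncated subtraction in the first.\<close>
  then have "multiplicity 2 ((2 * k) choose (2 * i)) \<le> s - multiplicity 2 (k + 1)"
    "multiplicity 2 (k + 1) \<le> s"
    using multiplicity_2_binomial_double[of i k] assms(3) by simp_all
  then have 3: "val2_ge (?v - int s) (inverse C)"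
    using val2_ge_inverse_of_nat_iff[of "(2 * k) choose (2 * i)" "s - multiplicity 2 (k + 1)"] assms(3)
    by (simp add: C_def of_nat_diff)
  \<comment> \<open>With \<open>v\<close> the valuation of \<open>k + 1\<close>, the exponents add
    up as \<open>(1 + v) + 0 + (v - s) + (e - s - 1) = e - 2 * s + 2 * v\<close>.\<close>
  show ?thesis unfolding T
    by (rule val2_ge_mono[OF val2_ge_mult[OF val2_ge_mult[OF val2_ge_mult[OF 1 2] 3] bracket]])
      (simp add: r_def)
qed

lemma val2_ge_T_middle:
  assumes "e \<ge> 1" "k < 2 ^ (e - 1)" "even k" "k + 2 < 2 ^ Suc s"
  shows "val2_ge (int e - 2 * int s) (T e k k)"
proof -
  define P :: rat where "P = (\<Prod>l<k. 1 + of_nat (2 ^ e) / of_nat (2 * k + 1 - l))"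
  have "(2::nat) ^ e = 2 * 2 ^ (e - 1)" using assms(1) by (cases e) auto
  then have small: "2 * k + 1 < 2 ^ e" using assms(2) by simp
  have P: "val2_ge (int e - int (Suc s)) (P - 1)" "val2_ge 1 (P - 1)"
    using val2_ge_prod_pow2_div_minus_1[of k "2 * k + 1" e "Suc s"] assms small
    by (simp_all add: P_def)
  obtain n where n: "k = 2 * n" using assms(3) by blast
  \<comment> \<open>Since \<open>k + 2 = 2 * (n + 1)\<close>, the bound \<open>n + 1\<close> leaves
    a factor 2 to spare. The valuation is thus at most \<open>s - 1\<close>, which makes up for the
    \<open>Suc s\<close> in \<open>P\<close>:
    \<open>-(s - 1) + (e - s - 1) = e - 2 * s\<close>.\<close>
  have "2 * 2 ^ multiplicity 2 ((2 * k + 1) choose k) < (2::nat) ^ Suc s"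
    using multiplicity_2_binomial_near_middle[OF n] assms(4) n by linarith
  then have "(2::nat) ^ multiplicity 2 ((2 * k + 1) choose k) < 2 ^ s" by simp
  then have "multiplicity 2 ((2 * k + 1) choose k) < s"
    by (metis one_less_numeral_iff power_less_imp_less_exp semiring_norm(76))
  then have C: "val2_ge (- int (s - 1)) (inverse (of_nat ((2 * k + 1) choose k)))" "s \<ge> 1"
    using val2_ge_inverse_of_nat_iff[of "(2 * k + 1) choose k" "s - 1"] by auto
  have "of_nat ((2 ^ e + (2 * k + 1)) choose k) = of_nat ((2 * k + 1) choose k) * P"
    unfolding P_def by (rule binomial_add_eq_prod) simp
  then have T: "T e k k = inverse (of_nat ((2 * k + 1) choose k)) * (inverse P - 1)"
    unfolding T_def by (simp add: algebra_simps del: binomial_Suc_Suc)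
  show ?thesis unfolding T
    by (rule val2_ge_mono[OF val2_ge_mult[OF C(1) val2_ge_inverse_minus_1[OF P]]])
      (use C(2) in simp)
qed

section \<open>Summation over pairs and the final statement\<close>

lemma sum_pairs: "(\<Sum>j<2 * n. f j) = (\<Sum>i<n. f (2 * i) + f (2 * i + 1))"
  for f :: "nat \<Rightarrow> 'a :: comm_monoid_add"
  by (induction n) (simp_all add: add.assoc)

lemma val2_ge_sum_T:
  assumes "e \<ge> 1" "k < 2 ^ (e - 1)" "k + 2 < 2 ^ Suc s"
  shows "val2_ge (int e - 2 * int s + 2 * int (multiplicity 2 (k + 1))) (\<Sum>i=0..k. T e k i)"
proof (cases "even k")
  case True
  then obtain n where n: "k = 2 * n" by blast
  \<comment> \<open>For even \<open>k\<close> the term with \<open>k + 1\<close> vanishes, so the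
    weaker bound on the unpaired term suffices.\<close>
  have "multiplicity 2 (k + 1) = 0" using True by (intro not_dvd_imp_multiplicity_0) simp
  then have "val2_ge (int e - 2 * int s + 2 * int (multiplicity 2 (k + 1))) (T e k k)"
    using val2_ge_T_middle[OF assms(1,2) True assms(3)] by simp
  moreover have "(\<Sum>i=0..k. T e k i) = (\<Sum>i<n. T e k (2 * i) + T e k (2 * i + 1)) + T e k k"
    unfolding sum_pairs[symmetric] n[symmetric] by (simp add: atLeast0AtMost lessThan_Suc_atMost[symmetric])
  ultimately show ?thesis
    using assms n by (simp only:) (rule val2_ge_add[OF val2_ge_sum], rule val2_ge_T_pair, simp_all)
next
  case False
  then obtain n where n: "k + 1 = 2 * n" by (metis even_plus_one_iff evenE)
  have "(\<Sum>i=0..k. T e k i) = (\<Sum>i<n. T e k (2 * i) + T e k (2 * i + 1))"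
    unfolding sum_pairs[symmetric] n[symmetric] by (simp add: atLeast0AtMost lessThan_Suc_atMost[symmetric])
  also have "val2_ge (int e - 2 * int s + 2 * int (multiplicity 2 (k + 1))) \<dots>"
    using assms n by (intro val2_ge_sum val2_ge_T_pair) auto
  finally show ?thesis .
qed

theorem theorem2p2:
  fixes e k :: nat
  assumes "e \<ge> 1" and "k < 2 ^ (e - 1)"
  shows "nu2 (\<Sum>i=0..k. T e k i)
           \<ge> ereal (of_int (int e - 2 * lg (real (k + 2)))) + 2 * nu2 (of_nat (k + 1))
       \<and> (\<forall>i::nat. int i \<le> \<lfloor>(real k - 1) / 2\<rfloor> \<longrightarrow>
           nu2 (T e k (2 * i) + T e k (2 * i + 1))
             \<ge> ereal (of_int (int e - 2 * lg (real (k + 1)))) + 2 * nu2 (of_nat (k + 1)))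
       \<and> (even k \<longrightarrow> nu2 (T e k k) \<ge> ereal (of_int (int e - 2 * lg (real (k + 2)))))"
proof -
  obtain s where s: "lg (real (k + 2)) = int s" "k + 2 < 2 ^ Suc s"
    by (rule lg_of_nat_eq[of "k + 2"]) auto
  obtain t where t: "lg (real (k + 1)) = int t" "k + 1 < 2 ^ Suc t"
    by (rule lg_of_nat_eq[of "k + 1"]) auto
  have rhs: "ereal (of_int m) + 2 * nu2 (of_nat (k + 1))
      = ereal (of_int (m + 2 * int (multiplicity 2 (k + 1))))" for m
    using nu2_of_nat[of "k + 1"] by simp
  \<comment> \<open>The subtraction is real: for \<open>k = 0\<close> the floor is -1 and no
    \<open>i\<close> qualifies.\<close>
  have index: "2 * i + 1 \<le> k" if "int i \<le> \<lfloor>(real k - 1) / 2\<rfloor>" for i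
    using that by (simp add: le_floor_iff)
  show ?thesis
    unfolding s(1) t(1) rhs
    using assms s(2) t(2) index
    by (intro conjI allI impI nu2_ge_if_val2_ge val2_ge_sum_T val2_ge_T_pair val2_ge_T_middle)
qed

end
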